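(* There are no complete FBD-graphs; that is, no FBD-graph $G=(V,E)$ has the property that for every two distinct vertices $u,v\in V$ either $(u,v)\in E$ or $(v,u)\in E$.
   Context: A finite simple oriented graph is a pair $G=(V,E)$ with $V$ a finite set and $E\subseteq\{(i,j)\in V\times V : i\neq j\}$ such that $(i,j)\in E$ implies $(j,i)\notin E$. Vertices $a,b,c\in V$ form a (directed) 3-cycle iff $(a,b),(b,c),(c,a)\in E$. An edge $(a,b)\in E$ is blocked iff there is a vertex $c\in V$ with $(a,c),(c,b)\in E$. A graph is fully blocked iff all of its edges are blocked. An FBD-graph is a fully blocked, finite, non-empty (i.e. having at least one edge) simple oriented graph without directed 3-cycles. *)

theory Defs
  imports "Graph_Theory.Pair_Digraph"
begin

(* pair_digraph: finite vertex set, arcs are pairs of distinct vertices. *)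
locale oriented_graph = pair_digraph G for G :: "'a pair_pre_digraph" +
  assumes no_opposite_arcs: "(i, j) \<in> parcs G \<Longrightarrow> (j, i) \<notin> parcs G"

lemma oriented_graph_iff:
  "oriented_graph G \<longleftrightarrow>
     finite (pverts G) \<and>
     parcs G \<subseteq> {(i, j) \<in> pverts G \<times> pverts G. i \<noteq> j} \<and>
     (\<forall>i j. (i, j) \<in> parcs G \<longrightarrow> (j, i) \<notin> parcs G)"
  (is "_ \<longleftrightarrow> ?R")
proof
  assume "oriented_graph G"
  then interpret oriented_graph G .
  show ?R
    using pair_finite_verts arc_fst_in_verts arc_snd_in_verts pair_no_loops no_opposite_arcs
    by fastforce
next
  assume R: ?R
  then have sub: "parcs G \<subseteq> pverts G \<times> pverts G"
    by blast
  then have "finite (parcs G)"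
    using R by (meson finite_SigmaI finite_subset)
  with R sub show "oriented_graph G"
    by unfold_locales auto
qed

definition three_cycle :: "'a pair_pre_digraph \<Rightarrow> 'a \<Rightarrow> 'a \<Rightarrow> 'a \<Rightarrow> bool" where
  "three_cycle G a b c \<longleftrightarrow> (a, b) \<in> parcs G \<and> (b, c) \<in> parcs G \<and> (c, a) \<in> parcs G"

definition blocked :: "'a pair_pre_digraph \<Rightarrow> 'a \<times> 'a \<Rightarrow> bool" where
  "blocked G = (\<lambda>(a, b). \<exists>c \<in> pverts G. (a, c) \<in> parcs G \<and> (c, b) \<in> parcs G)"

definition fully_blocked :: "'a pair_pre_digraph \<Rightarrow> bool" where
  "fully_blocked G \<longleftrightarrow> (\<forall>e \<in> parcs G. blocked G e)"

definition FBD_graph :: "'a pair_pre_digraph \<Rightarrow> bool" where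
  "FBD_graph G \<longleftrightarrow>
     oriented_graph G \<and> parcs G \<noteq> {} \<and> fully_blocked G \<and>
     \<not> (\<exists>a \<in> pverts G. \<exists>b \<in> pverts G. \<exists>c \<in> pverts G. three_cycle G a b c)"

(* Completeness in the sense of oriented graphs (a tournament), unlike
   Graph_Theory.Kuratowski.complete_digraph, where both directions are present. *)
definition complete_oriented :: "'a pair_pre_digraph \<Rightarrow> bool" where
  "complete_oriented G \<longleftrightarrow>
     (\<forall>u \<in> pverts G. \<forall>v \<in> pverts G. u \<noteq> v \<longrightarrow> (u, v) \<in> parcs G \<or> (v, u) \<in> parcs G)"

end

theory Submission
  imports Defs
begin

text \<open>A tournament without directed 3-cycles is transitive, so its arcs form a finite strict
  order, and a blocked arc is one with a vertex strictly between its ends. Full blockedness thus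
  says that this order is dense, and a finite strict order with at least one pair is never dense:
  an element has an immediate successor as soon as it has any successor.\<close>

lemma three_cycle_free_tournament_trans:
  assumes "oriented_graph G" and "complete_oriented G"
    and no_cycle: "\<not> (\<exists>a \<in> pverts G. \<exists>b \<in> pverts G. \<exists>c \<in> pverts G. three_cycle G a b c)"
  shows "trans (parcs G)"
proof (rule transI)
  fix a b c
  assume ab: "(a, b) \<in> parcs G" and bc: "(b, c) \<in> parcs G"
  interpret oriented_graph G by fact
  have verts: "a \<in> pverts G" "b \<in> pverts G" "c \<in> pverts G"
    using ab bc by (auto dest: in_arcsD1 in_arcsD2)
  have "a \<noteq> c"
    using ab bc no_opposite_arcs by blast
  moreover have "(c, a) \<notin> parcs G"
    using ab bc verts no_cycle unfolding three_cycle_def by blast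
  ultimately show "(a, c) \<in> parcs G"
    using verts \<open>complete_oriented G\<close> unfolding complete_oriented_def by blast
qed

lemma finite_dense_strict_order_empty:
  assumes "finite r" "trans r" "irrefl r"
    and dense: "\<And>a b. (a, b) \<in> r \<Longrightarrow> \<exists>c. (a, c) \<in> r \<and> (c, b) \<in> r"
  shows "r = {}"
proof (rule ccontr)
  assume "r \<noteq> {}"
  then obtain a b where "(a, b) \<in> r"
    by auto
  have "wf r"
    using assms(1-3) by (simp add: finite_acyclic_wf acyclic_irrefl)
  \<comment> \<open>An immediate successor of \<open>a\<close>: a minimal element among all its successors.\<close>
  then obtain m where "(a, m) \<in> r" and minimal: "\<And>c. (c, m) \<in> r \<Longrightarrow> (a, c) \<notin> r"
    using \<open>(a, b) \<in> r\<close> by (auto elim: wfE_min[where x = b and Q = "{x. (a, x) \<in> r}"])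
  then show False
    using dense by blast
qed

theorem lemma1:
  shows "\<not> (\<exists>G :: 'a pair_pre_digraph. FBD_graph G \<and> complete_oriented G)"
proof
  assume "\<exists>G :: 'a pair_pre_digraph. FBD_graph G \<and> complete_oriented G"
  then obtain G :: "'a pair_pre_digraph" where "FBD_graph G" and "complete_oriented G"
    by blast
  then have "oriented_graph G" and nonempty: "parcs G \<noteq> {}" and "fully_blocked G"
    and "trans (parcs G)"
    by (auto simp: FBD_graph_def intro: three_cycle_free_tournament_trans)
  interpret oriented_graph G by fact
  have "irrefl (parcs G)"
    using no_opposite_arcs by (auto simp: irrefl_def)
  moreover have "\<exists>c. (a, c) \<in> parcs G \<and> (c, b) \<in> parcs G" if "(a, b) \<in> parcs G" for a b
    using that \<open>fully_blocked G\<close> by (auto simp: fully_blocked_def blocked_def)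
  ultimately show False
    using finite_dense_strict_order_empty[OF pair_finite_arcs \<open>trans (parcs G)\<close>] nonempty by blast
qed

end
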